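(* Let $q\ge 2$, $d\ge1$ be integers and $\alpha\in[0,1)$. On the infinite $(q+1)$-regular tree $\mathbb{T}_{q+1}$, let $X,Y$ be vertices with $\operatorname{dist}(X,Y)=d$, and let $\mathfrak{m}_X^n,\mathfrak{m}_Y^n$ be the distributions after $n$ steps of the simple random walk with laziness $\alpha$ started at $X$, respectively $Y$. Put $\delta=\lfloor d/2\rfloor$, $\delta'=\lceil d/2\rceil$. Then, as $n\to\infty$, \[ W_1(\mathfrak{m}_X^n, \mathfrak{m}_Y^n) = A^{\mathrm{SRW}}_{\alpha, d, q} \cdot n + B^{\mathrm{SRW}}_{\alpha, d, q} + o(1), \] where \[ A^{\mathrm{SRW}}_{\alpha, d, q} = 2(1-\alpha)(q+1 - q^{1-\delta'} - q^{-\delta}) \cdot \frac{q-1}{(q+1)^2},\qquad B^{\mathrm{SRW}}_{\alpha, d, q} = d + \frac{2(\delta q^{-\delta} + \delta' q^{1-\delta'})}{q+1} + \frac{2(q^{1-\delta} - q^{1-\delta'})}{(q+1)^2}. \]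
   Context: The simple random walk with laziness $\alpha$ from $u$: $p_0=u$, and at each step $p_{i+1}=p_i$ with probability $\alpha$ and $p_{i+1}=w$ with probability $\frac{1-\alpha}{q+1}$ for each neighbor $w$ of $p_i$; $\mathfrak{m}_u^n(v)=\mathbb{P}(p_n=v)$. $W_1$ is the $1$-Wasserstein distance with respect to graph distance: the minimum over couplings $\pi$ of $\mu,\nu$ of $\sum_{v,w}\operatorname{dist}(v,w)\pi(v,w)$. *)

theory Defs
  imports "HOL-Probability.Probability" "HOL-Library.Landau_Symbols"
begin

section \<open>Regular trees\<close>

text \<open>A graph is given by its adjacency relation; the vertex set is the whole type.\<close>

definition neighbors :: "('v \<Rightarrow> 'v \<Rightarrow> bool) \<Rightarrow> 'v \<Rightarrow> 'v set" where
  "neighbors E u = {w. E u w}"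

definition simple_graph :: "('v \<Rightarrow> 'v \<Rightarrow> bool) \<Rightarrow> bool" where
  "simple_graph E \<longleftrightarrow> symp E \<and> irreflp E"

definition connected_graph :: "('v \<Rightarrow> 'v \<Rightarrow> bool) \<Rightarrow> bool" where
  "connected_graph E \<longleftrightarrow> (\<forall>u v. E\<^sup>*\<^sup>* u v)"

definition is_cycle :: "('v \<Rightarrow> 'v \<Rightarrow> bool) \<Rightarrow> 'v list \<Rightarrow> bool" where
  "is_cycle E vs \<longleftrightarrow> length vs \<ge> 3 \<and> distinct vs \<and> successively E (vs @ [hd vs])"

definition is_tree :: "('v \<Rightarrow> 'v \<Rightarrow> bool) \<Rightarrow> bool" where
  "is_tree E \<longleftrightarrow> simple_graph E \<and> connected_graph E \<and> (\<nexists>vs. is_cycle E vs)"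

definition regular_graph :: "nat \<Rightarrow> ('v \<Rightarrow> 'v \<Rightarrow> bool) \<Rightarrow> bool" where
  "regular_graph k E \<longleftrightarrow> (\<forall>u. finite (neighbors E u) \<and> card (neighbors E u) = k)"

text \<open>Two vertices are related by the \<open>k\<close>-fold relational power of \<open>E\<close> iff they are
  joined by a walk with \<open>k\<close> edges. The value is meaningful for connected graphs only.\<close>

definition graph_dist :: "('v \<Rightarrow> 'v \<Rightarrow> bool) \<Rightarrow> 'v \<Rightarrow> 'v \<Rightarrow> nat" where
  "graph_dist E u v = (LEAST k. (E ^^ k) u v)"

section \<open>Lazy simple random walk\<close>

definition lazy_step :: "('v \<Rightarrow> 'v \<Rightarrow> bool) \<Rightarrow> real \<Rightarrow> 'v \<Rightarrow> 'v pmf" where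
  "lazy_step E \<alpha> u =
     bernoulli_pmf \<alpha> \<bind> (\<lambda>stay. if stay then return_pmf u else pmf_of_set (neighbors E u))"

primrec lazy_walk :: "('v \<Rightarrow> 'v \<Rightarrow> bool) \<Rightarrow> real \<Rightarrow> 'v \<Rightarrow> nat \<Rightarrow> 'v pmf" where
  "lazy_walk E \<alpha> u 0 = return_pmf u"
| "lazy_walk E \<alpha> u (Suc n) = lazy_walk E \<alpha> u n \<bind> lazy_step E \<alpha>"

lemma pmf_lazy_step:
  assumes "simple_graph E" "regular_graph (q + 1) E" "0 \<le> \<alpha>" "\<alpha> \<le> 1"
  shows "pmf (lazy_step E \<alpha> u) w =
           (if w = u then \<alpha> else if w \<in> neighbors E u then (1 - \<alpha>) / (real q + 1) else 0)"
proof -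
  have fin: "finite (neighbors E u)" and c: "card (neighbors E u) = q + 1"
    using assms(2) by (auto simp: regular_graph_def)
  have ne: "neighbors E u \<noteq> {}"
    using c by auto
  have "u \<notin> neighbors E u"
    using assms(1) by (auto simp: simple_graph_def neighbors_def irreflp_def)
  then show ?thesis
    using assms(3,4) fin ne c
    by (auto simp: lazy_step_def pmf_bind pmf_of_set indicator_def add.commute)
qed

section \<open>The 1-Wasserstein distance\<close>

definition couplings :: "'v pmf \<Rightarrow> 'v pmf \<Rightarrow> ('v \<times> 'v) pmf set" where
  "couplings \<mu> \<nu> = {\<pi>. map_pmf fst \<pi> = \<mu> \<and> map_pmf snd \<pi> = \<nu>}"

definition transport_cost :: "('v \<Rightarrow> 'v \<Rightarrow> bool) \<Rightarrow> ('v \<times> 'v) pmf \<Rightarrow> ennreal" where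
  "transport_cost E \<pi> = (\<integral>\<^sup>+ (v, w). ennreal (real (graph_dist E v w)) \<partial>measure_pmf \<pi>)"

text \<open>The infimum is the minimum whenever the latter exists, in particular for finitely
  supported \<open>\<mu>\<close>, \<open>\<nu>\<close>. Beware that \<open>enn2real\<close> sends an infinite cost to 0;
  this does not occur for finitely supported \<open>\<mu>\<close>, \<open>\<nu>\<close>.\<close>

definition wasserstein1 :: "('v \<Rightarrow> 'v \<Rightarrow> bool) \<Rightarrow> 'v pmf \<Rightarrow> 'v pmf \<Rightarrow> real" where
  "wasserstein1 E \<mu> \<nu> = enn2real (INF \<pi> \<in> couplings \<mu> \<nu>. transport_cost E \<pi>)"

lemma wasserstein1_eq_min:
  assumes "\<pi> \<in> couplings \<mu> \<nu>"
    and "\<And>\<pi>'. \<pi>' \<in> couplings \<mu> \<nu> \<Longrightarrow> transport_cost E \<pi> \<le> transport_cost E \<pi>'"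
  shows "wasserstein1 E \<mu> \<nu> = enn2real (transport_cost E \<pi>)"
proof -
  have "(INF \<pi> \<in> couplings \<mu> \<nu>. transport_cost E \<pi>) = transport_cost E \<pi>"
    using assms by (intro antisym INF_lower INF_greatest)
  then show ?thesis
    by (simp add: wasserstein1_def)
qed

section \<open>The coefficients of the asymptotic expansion\<close>

definition A_SRW :: "real \<Rightarrow> nat \<Rightarrow> nat \<Rightarrow> real" where
  "A_SRW \<alpha> d q =
    (let \<delta> = \<lfloor>real d / 2\<rfloor>; \<delta>' = \<lceil>real d / 2\<rceil>; Q = real q in
     2 * (1 - \<alpha>) * (Q + 1 - Q powi (1 - \<delta>') - Q powi (- \<delta>)) * ((Q - 1) / (Q + 1)\<^sup>2))"

definition B_SRW :: "real \<Rightarrow> nat \<Rightarrow> nat \<Rightarrow> real" where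
  "B_SRW \<alpha> d q =
    (let \<delta> = \<lfloor>real d / 2\<rfloor>; \<delta>' = \<lceil>real d / 2\<rceil>; Q = real q in
     real d
     + 2 * (of_int \<delta> * Q powi (- \<delta>) + of_int \<delta>' * Q powi (1 - \<delta>')) / (Q + 1)
     + 2 * (Q powi (1 - \<delta>) - Q powi (1 - \<delta>')) / (Q + 1)\<^sup>2)"

end

theory Submission
  imports Defs
begin

text \<open>
  Let \<open>a\<close> and \<open>b\<close> be the distances of a vertex to \<open>X\<close> and \<open>Y\<close>. The function \<open>f\<close> equal to
  \<open>b - d/2\<close> where \<open>a < b\<close>, to \<open>d/2 - a\<close> where \<open>b < a\<close>, and to \<open>0\<close> where \<open>a = b\<close> is,
  up to the last case, the signed distance to the midpoint of the geodesic from \<open>X\<close> to \<open>Y\<close>. By the four-point condition it is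
  1-Lipschitz, and \<open>dist v w = f v - f w\<close> whenever \<open>v\<close> is closer to \<open>X\<close> and \<open>w\<close> is closer to
  \<open>Y\<close>. Hence \<open>W\<^sub>1\<close> is the difference of the expectations of \<open>f\<close> as soon as some coupling cancels
  locally the mass of the walk from \<open>Y\<close> near \<open>X\<close> and that of the walk from \<open>X\<close> near \<open>Y\<close>; the
  rest may be coupled arbitrarily. The probability of a vertex decreases along steps of length two
  in its distance from the start, so the cancellation can be done in place if \<open>d\<close> is even, and
  by moving mass along single edges if \<open>d\<close> is odd.

  The expectations are computed with a martingale. The generator maps \<open>f\<close> to a multiple of
  the sign of \<open>f\<close>; adding to \<open>f\<close> a correction of the form \<open>(C r - C') q\<^sup>-\<^sup>r\<close> replaces the sign by a
  harmonic function. The correction has vanishing expectation since the expectation of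
  \<open>q\<^sup>-\<^sup>a\<^sup>/\<^sup>2\<close> decays geometrically.
\<close>

section \<open>Distances in trees\<close>

text \<open>Loop erasure: when the walk returns to a visited vertex, the path is cut back to that
  vertex.\<close>

lemma rtranclp_distinct_path:
  assumes "R\<^sup>*\<^sup>* x y"
  shows "\<exists>vs. vs \<noteq> [] \<and> hd vs = x \<and> last vs = y \<and> distinct vs \<and> successively R vs"
  using assms
proof (induction rule: rtranclp_induct)
  case base
  show ?case by (intro exI[of _ "[x]"]) auto
next
  case (step y z)
  then obtain vs where vs: "vs \<noteq> []" "hd vs = x" "last vs = y" "distinct vs" "successively R vs"
    by blast
  show ?case
  proof (cases "z \<in> set vs")
    case True
    then obtain ys zs where "vs = ys @ z # zs"
      by (meson split_list)
    with vs show ?thesis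
      by (intro exI[of _ "ys @ [z]"]) (auto simp: successively_append_iff hd_append split: if_splits)
  next
    case False
    with vs step.hyps show ?thesis
      by (intro exI[of _ "vs @ [z]"]) (auto simp: successively_append_iff)
  qed
qed

locale tree_graph =
  fixes E :: "'v \<Rightarrow> 'v \<Rightarrow> bool"
  assumes tree: "is_tree E"
begin

abbreviation D :: "'v \<Rightarrow> 'v \<Rightarrow> nat" where "D \<equiv> graph_dist E"

lemma adj_sym: "E u v \<Longrightarrow> E v u"
  using tree by (auto simp: is_tree_def simple_graph_def symp_def)

lemma adj_irrefl: "\<not> E u u"
  using tree by (auto simp: is_tree_def simple_graph_def irreflp_def)

lemma dist_walk: "(E ^^ D u v) u v"
proof -
  have "\<exists>k. (E ^^ k) u v"
    using tree rtranclp_imp_relpowp[of E u v] by (auto simp: is_tree_def connected_graph_def)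
  then show ?thesis
    unfolding graph_dist_def by (rule LeastI_ex)
qed

lemma dist_le_walk: "(E ^^ k) u v \<Longrightarrow> D u v \<le> k"
  unfolding graph_dist_def by (rule Least_le)

lemma dist_self [simp]: "D u u = 0"
  using dist_le_walk[of 0 u u] by simp

lemma dist_eq_0_iff [simp]: "D u v = 0 \<longleftrightarrow> u = v"
  using dist_walk[of u v] by auto

lemma relpowp_sym: "(E ^^ k) u v \<Longrightarrow> (E ^^ k) v u"
proof (induction k arbitrary: v)
  case (Suc k)
  then show ?case
    by (metis adj_sym relpowp_Suc_E relpowp_Suc_I2)
qed auto

lemma dist_commute: "D u v = D v u"
  using dist_le_walk[OF relpowp_sym[OF dist_walk]] by (metis le_antisym)

lemma dist_triangle: "D u w \<le> D u v + D v w"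
  by (rule dist_le_walk, rule relpowp_trans, rule dist_walk, rule dist_walk)

lemma dist_adj: "E u v \<Longrightarrow> D u v = 1"
  using dist_le_walk[of 1 u v] dist_eq_0_iff[of u v] adj_irrefl[of u]
  by (cases "D u v") (auto simp del: dist_eq_0_iff)

lemma dist_adj_le: "E v w \<Longrightarrow> D w u \<le> D v u + 1"
  using dist_triangle[of w u v] dist_adj[of w v] adj_sym by fastforce

lemma ex_closer_neighbor:
  assumes "v \<noteq> u"
  shows "\<exists>w. E v w \<and> D v u = D w u + 1"
proof -
  obtain k where k: "D v u = Suc k"
    using assms by (cases "D v u") auto
  with dist_walk[of v u] obtain w where w: "E v w" "(E ^^ k) w u"
    by (metis relpowp_Suc_D2)
  have "D w u \<le> k" using dist_le_walk w by blast
  moreover have "D v u \<le> D w u + 1" using dist_adj_le w(1) adj_sym by blast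
  ultimately show ?thesis using w k by force
qed

text \<open>A simple path from \<open>w\<close> to \<open>w'\<close> that avoids \<open>v\<close>
  would close up through \<open>v\<close> to a cycle.\<close>

lemma no_two_paths:
  assumes "E v w" "E v w'" "(\<lambda>x y. E x y \<and> x \<noteq> v \<and> y \<noteq> v)\<^sup>*\<^sup>* w w'"
  shows "w = w'"
proof (rule ccontr)
  assume ne: "w \<noteq> w'"
  let ?R = "\<lambda>x y. E x y \<and> x \<noteq> v \<and> y \<noteq> v"
  obtain vs where vs: "vs \<noteq> []" "hd vs = w" "last vs = w'" "distinct vs" "successively ?R vs"
    using rtranclp_distinct_path[OF assms(3)] by blast
  have s: "successively E vs"
    using vs(5) by (rule successively_mono) auto
  obtain x y zs where xy: "vs = x # y # zs"
    using vs(1-3) ne by (cases vs; cases "tl vs") auto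
  \<comment> \<open>Since \<open>w \<noteq> w'\<close>, the path has an edge, so each of its
    vertices lies on an edge of \<open>?R\<close> and differs from \<open>v\<close>.\<close>
  have "v \<notin> set vs"
  proof -
    have "successively ?R us \<Longrightarrow> length us \<ge> 2 \<Longrightarrow> v \<notin> set us" for us
    proof (induction us)
      case (Cons u us)
      then show ?case
        by (cases us; cases "tl us") auto
    qed auto
    from this[of vs] vs(5) xy show ?thesis by simp
  qed
  moreover have "successively E ((v # vs) @ [v])"
  proof -
    have "E w' v" using assms(2) adj_sym by blast
    then show ?thesis
      using s vs(1-3) assms(1) by (simp add: successively_append_iff successively_Cons)
  qed
  ultimately have "is_cycle E (v # vs)"
    using vs(4) xy by (simp add: is_cycle_def)
  then show False using tree by (auto simp: is_tree_def)
qed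

text \<open>Every vertex after \<open>w\<close> on a geodesic to \<open>u\<close> is strictly closer
  to \<open>u\<close> than \<open>v\<close> is.\<close>

lemma geodesic_avoids:
  assumes "w \<noteq> v" "D w u \<le> D v u"
  shows "(\<lambda>x y. E x y \<and> x \<noteq> v \<and> y \<noteq> v)\<^sup>*\<^sup>* w u"
  using assms
proof (induction "D w u" arbitrary: w)
  case (Suc k)
  then have "w \<noteq> u" by auto
  then obtain w1 where w1: "E w w1" "D w u = D w1 u + 1"
    using ex_closer_neighbor by blast
  then have "w1 \<noteq> v" using Suc by auto
  then have "(\<lambda>x y. E x y \<and> x \<noteq> v \<and> y \<noteq> v)\<^sup>*\<^sup>* w1 u"
    using Suc w1 by auto
  then show ?case
    using w1 Suc.prems \<open>w1 \<noteq> v\<close> by (intro converse_rtranclp_into_rtranclp[of _ w w1]) auto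
qed auto

text \<open>Geodesics from \<open>w\<close> and \<open>w'\<close> to \<open>u\<close> both avoid
  \<open>v\<close> and join up. The weak inequalities serve to exclude edges between vertices
  equidistant from \<open>u\<close>.\<close>

lemma closer_neighbor_unique:
  assumes "E v w" "E v w'" "D w u \<le> D v u" "D w' u \<le> D v u"
  shows "w = w'"
proof (rule no_two_paths[OF assms(1,2)])
  let ?R = "\<lambda>x y. E x y \<and> x \<noteq> v \<and> y \<noteq> v"
  have ne: "w \<noteq> v" "w' \<noteq> v" using assms adj_irrefl by auto
  have "symp ?R" using adj_sym by (auto simp: symp_def)
  then have "symp (?R\<^sup>*\<^sup>*)" by (rule symp_rtranclp)
  then have "?R\<^sup>*\<^sup>* u w'"
    using geodesic_avoids[OF ne(2) assms(4)] by (auto simp: symp_def)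
  then show "?R\<^sup>*\<^sup>* w w'"
    using geodesic_avoids[OF ne(1) assms(3)] by (meson rtranclp_trans)
qed

lemma dist_neighbor_cases:
  assumes "E v w"
  shows "D w u = D v u + 1 \<or> D v u = D w u + 1"
proof (cases "D w u \<le> D v u")
  case True
  have "v \<noteq> u"
    using True assms adj_irrefl by fastforce
  then obtain w' where w': "E v w'" "D v u = D w' u + 1"
    using ex_closer_neighbor by blast
  have "w = w'"
    using closer_neighbor_unique[OF assms w'(1), of u] True w'(2) by simp
  then show ?thesis using w' by simp
next
  case False
  then show ?thesis using dist_adj_le[OF assms, of u] by simp
qed

text \<open>A step away from \<open>y\<close> is never undone along a geodesic to \<open>w\<close>:
  the only neighbor closer to \<open>y\<close> is the vertex just left.\<close>

lemma dist_through:
  assumes "E v v'" "D v w = D v' w + 1" "D v' y = D v y + 1"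
  shows "D w y = D w v + D v y"
  using assms
proof (induction "D v' w" arbitrary: v v')
  case 0
  then have "v' = w" by simp
  then show ?case using 0 dist_commute[of w v] by simp
next
  case (Suc k)
  then have "v' \<noteq> w" by auto
  then obtain v'' where v'': "E v' v''" "D v' w = D v'' w + 1"
    using ex_closer_neighbor by blast
  have "v'' \<noteq> v" using v'' Suc by auto
  then have "D v'' y = D v' y + 1"
    using closer_neighbor_unique[of v' v'' v y] v'' Suc.prems adj_sym[of v v']
      dist_neighbor_cases[OF v''(1), of y] by auto
  then have "D w y = D w v' + D v' y"
    using Suc.hyps(1)[of v'' v'] Suc.hyps(2) v'' by auto
  then show ?case
    using Suc.prems dist_commute[of w v] dist_commute[of w v'] by auto
qed

text \<open>The two largest of the three pair sums agree. Induction moves \<open>v\<close> towards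
  \<open>w\<close>: this step must approach \<open>y\<close>, and if it recedes from
  \<open>x\<close>, then \<open>v\<close> lies on the geodesics from \<open>x\<close> to both
  \<open>w\<close> and \<open>y\<close>.\<close>

lemma four_point:
  assumes "D v x + D w y < D v y + D w x"
  shows "D v w + D x y = D v y + D w x"
  using assms
proof (induction "D v w" arbitrary: v)
  case 0
  then have "v = w" by simp
  then show ?case using 0 by simp
next
  case (Suc k)
  then have "v \<noteq> w" by auto
  then obtain v' where v': "E v v'" "D v w = D v' w + 1"
    using ex_closer_neighbor by blast
  have y: "D v y = D v' y + 1"
  proof (rule ccontr)
    assume "\<not> ?thesis"
    then have "D w y = D w v + D v y"
      using dist_through[OF v'] dist_neighbor_cases[OF v'(1), of y] by auto
    then show False
      using Suc.prems dist_triangle[of w x v] by simp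
  qed
  consider "D v x = D v' x + 1" | "D v' x = D v x + 1"
    using dist_neighbor_cases[OF v'(1), of x] by auto
  then show ?case
  proof cases
    case 1
    then show ?thesis using Suc v' y by auto
  next
    case 2
    have "D y x = D y v + D v x" "D w x = D w v + D v x"
      using dist_through[OF v'(1) y 2] dist_through[OF v' 2] by auto
    then show ?thesis
      using dist_commute[of x y] dist_commute[of v w] dist_commute[of v y] by simp
  qed
qed

lemma even_dist_sum: "even (D v x + D v y + D x y)"
proof (induction "D v x" arbitrary: v)
  case (Suc k)
  then have "v \<noteq> x" by auto
  then obtain v' where v': "E v v'" "D v x = D v' x + 1"
    using ex_closer_neighbor by blast
  then have "even (D v' x + D v' y + D x y)" using Suc by auto
  then show ?case using v' dist_neighbor_cases[OF v'(1), of y] by auto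
qed auto

end

section \<open>Optimal couplings\<close>

text \<open>The leftovers \<open>e\<close> and \<open>g\<close> have the same total
  \<open>M\<close>, so they can be coupled by the product plan \<open>e v * g w / M\<close>, which
  charges only pairs with leftover on both sides.\<close>

lemma coupling_extension:
  fixes \<mu> \<nu> :: "'v pmf" and \<kappa> :: "'v \<Rightarrow> 'v \<Rightarrow> real"
  assumes S: "finite S" "set_pmf \<mu> \<subseteq> S" "set_pmf \<nu> \<subseteq> S"
    and nonneg: "\<And>v w. 0 \<le> \<kappa> v w"
    and row: "\<And>v. v \<in> S \<Longrightarrow> (\<Sum>w\<in>S. \<kappa> v w) \<le> pmf \<mu> v"
    and col: "\<And>w. w \<in> S \<Longrightarrow> (\<Sum>v\<in>S. \<kappa> v w) \<le> pmf \<nu> w"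
  obtains \<pi> where "\<pi> \<in> couplings \<mu> \<nu>"
    and "\<And>v w. (v, w) \<in> set_pmf \<pi> \<Longrightarrow> \<kappa> v w > 0 \<or>
           (v \<in> S \<and> w \<in> S \<and> (\<Sum>w\<in>S. \<kappa> v w) < pmf \<mu> v \<and> (\<Sum>v\<in>S. \<kappa> v w) < pmf \<nu> w)"
proof -
  define e where "e v = pmf \<mu> v - (\<Sum>w\<in>S. \<kappa> v w)" for v
  define g where "g w = pmf \<nu> w - (\<Sum>v\<in>S. \<kappa> v w)" for w
  define M where "M = (\<Sum>v\<in>S. e v)"
  define F where "F x = (if x \<in> S \<times> S then \<kappa> (fst x) (snd x) + e (fst x) * g (snd x) / M else 0)"
    for x
  have e0: "0 \<le> e v" if "v \<in> S" for v using row[OF that] by (simp add: e_def)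
  have g0: "0 \<le> g v" if "v \<in> S" for v using col[OF that] by (simp add: g_def)
  have "(\<Sum>v\<in>S. pmf \<mu> v) = 1" "(\<Sum>v\<in>S. pmf \<nu> v) = 1"
    using S by (auto intro: sum_pmf_eq_1)
  then have M_g: "M = (\<Sum>w\<in>S. g w)"
    unfolding M_def e_def g_def sum_subtractf using sum.swap[of \<kappa> S S] by simp
  have M0: "0 \<le> M" unfolding M_def using e0 by (simp add: sum_nonneg)
  have F0: "0 \<le> F x" for x
    unfolding F_def using nonneg e0 g0 M0 by auto
  have rowF: "(\<Sum>w\<in>S. F (v, w)) = pmf \<mu> v" if v: "v \<in> S" for v
  proof -
    have "(\<Sum>w\<in>S. F (v, w)) = (\<Sum>w\<in>S. \<kappa> v w) + e v * M / M"
      using v unfolding F_def M_g by (simp add: sum.distrib sum_distrib_left sum_divide_distrib)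
    \<comment> \<open>If \<open>M = 0\<close>, the division yields 0, which is correct because the
      nonnegative leftovers then vanish.\<close>
    also have "e v * M / M = e v"
      using v e0 S(1) sum_nonneg_eq_0_iff[of S e] by (cases "M = 0") (auto simp: M_def)
    finally show ?thesis by (simp add: e_def)
  qed
  have colF: "(\<Sum>v\<in>S. F (v, w)) = pmf \<nu> w" if w: "w \<in> S" for w
  proof -
    have "(\<Sum>v\<in>S. F (v, w)) = (\<Sum>v\<in>S. \<kappa> v w) + M * g w / M"
      using w unfolding F_def M_def
      by (simp add: sum.distrib sum_distrib_right sum_divide_distrib)
    also have "M * g w / M = g w"
      using w g0 S(1) sum_nonneg_eq_0_iff[of S g] by (cases "M = 0") (auto simp: M_g)
    finally show ?thesis by (simp add: g_def)
  qed
  have "(\<integral>\<^sup>+ x. ennreal (F x) \<partial>count_space UNIV) = (\<Sum>x\<in>S \<times> S. ennreal (F x))"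
    using S(1) by (intro nn_integral_count_space') (auto simp: F_def)
  also have "\<dots> = ennreal (\<Sum>x\<in>S \<times> S. F x)"
    using F0 by (simp add: sum_ennreal)
  also have "(\<Sum>x\<in>S \<times> S. F x) = (\<Sum>v\<in>S. \<Sum>w\<in>S. F (v, w))"
    by (simp add: sum.cartesian_product)
  also have "\<dots> = 1"
    using rowF \<open>(\<Sum>v\<in>S. pmf \<mu> v) = 1\<close> by simp
  finally have pmf_P: "pmf (embed_pmf F) x = F x" for x
    using F0 by (intro pmf_embed_pmf) auto
  let ?P = "embed_pmf F"
  have "pmf (map_pmf fst ?P) v = pmf \<mu> v" for v
  proof (cases "v \<in> S")
    case True
    have "pmf (map_pmf fst ?P) v = measure ?P ({v} \<times> S)"
      unfolding pmf_map by (rule measure_prob_cong_0) (auto simp: pmf_P F_def)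
    also have "\<dots> = (\<Sum>w\<in>S. F (v, w))"
      using S(1) sum.cartesian_product[of "\<lambda>a b. F (a, b)" S "{v}"]
      by (simp add: measure_measure_pmf_finite pmf_P)
    finally show ?thesis using rowF True by simp
  next
    case False
    have "pmf (map_pmf fst ?P) v = measure ?P {}"
      unfolding pmf_map by (rule measure_prob_cong_0) (use False in \<open>auto simp: pmf_P F_def\<close>)
    then show ?thesis using False S by (auto simp: set_pmf_iff)
  qed
  moreover have "pmf (map_pmf snd ?P) w = pmf \<nu> w" for w
  proof (cases "w \<in> S")
    case True
    have "pmf (map_pmf snd ?P) w = measure ?P (S \<times> {w})"
      unfolding pmf_map by (rule measure_prob_cong_0) (auto simp: pmf_P F_def)
    also have "\<dots> = (\<Sum>v\<in>S. F (v, w))"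
      using S(1) sum.cartesian_product[of "\<lambda>a b. F (a, b)" "{w}" S]
      by (simp add: measure_measure_pmf_finite pmf_P)
    finally show ?thesis using colF True by simp
  next
    case False
    have "pmf (map_pmf snd ?P) w = measure ?P {}"
      unfolding pmf_map by (rule measure_prob_cong_0) (use False in \<open>auto simp: pmf_P F_def\<close>)
    then show ?thesis using False S by (auto simp: set_pmf_iff)
  qed
  ultimately have "?P \<in> couplings \<mu> \<nu>"
    by (auto simp: couplings_def intro!: pmf_eqI)
  moreover have "\<kappa> v w > 0 \<or> (v \<in> S \<and> w \<in> S \<and> (\<Sum>w\<in>S. \<kappa> v w) < pmf \<mu> v \<and> (\<Sum>v\<in>S. \<kappa> v w) < pmf \<nu> w)"
    if "(v, w) \<in> set_pmf ?P" for v w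
  proof (rule ccontr)
    assume neg: "\<not> ?thesis"
    have "F (v, w) \<noteq> 0" using that by (simp add: set_pmf_iff pmf_P)
    then have vw: "v \<in> S" "w \<in> S" and "\<kappa> v w + e v * g w / M \<noteq> 0"
      by (auto simp: F_def split: if_splits)
    moreover have "\<kappa> v w = 0" using neg nonneg[of v w] by auto
    ultimately have "e v \<noteq> 0" "g w \<noteq> 0" by auto
    then have "e v > 0" "g w > 0" using e0 g0 vw by (auto simp: less_le)
    then show False using neg vw by (simp add: e_def g_def)
  qed
  ultimately show ?thesis using that by blast
qed

text \<open>The easy half of Kantorovich duality: the Lipschitz bound integrates to a lower bound
  for every coupling, attained by \<open>\<pi>\<close>.\<close>

lemma wasserstein1_eq_potential:
  fixes f :: "'v \<Rightarrow> real"
  assumes fin: "finite (set_pmf \<mu>)" "finite (set_pmf \<nu>)"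
    and lip: "\<And>v w. f v - f w \<le> real (graph_dist E v w)"
    and \<pi>: "\<pi> \<in> couplings \<mu> \<nu>"
    and tight: "\<And>v w. (v, w) \<in> set_pmf \<pi> \<Longrightarrow> real (graph_dist E v w) = f v - f w"
  shows "wasserstein1 E \<mu> \<nu> = measure_pmf.expectation \<mu> f - measure_pmf.expectation \<nu> f"
proof -
  let ?d = "\<lambda>x. real (graph_dist E (fst x) (snd x))"
  have fin': "finite (set_pmf \<rho>)" if "\<rho> \<in> couplings \<mu> \<nu>" for \<rho>
  proof -
    have "set_pmf \<mu> = fst ` set_pmf \<rho>" "set_pmf \<nu> = snd ` set_pmf \<rho>"
      using that unfolding couplings_def by (metis (mono_tags, lifting) mem_Collect_eq set_map_pmf)+
    then have "set_pmf \<rho> \<subseteq> set_pmf \<mu> \<times> set_pmf \<nu>"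
      by (simp add: subset_fst_snd)
    then show ?thesis using fin finite_subset by blast
  qed
  have cost: "transport_cost E \<rho> = ennreal (measure_pmf.expectation \<rho> ?d)"
    if "\<rho> \<in> couplings \<mu> \<nu>" for \<rho>
    unfolding transport_cost_def case_prod_beta
    by (rule nn_integral_eq_integral) (auto intro: integrable_measure_pmf_finite fin' that)
  have diff: "measure_pmf.expectation \<rho> (\<lambda>x. f (fst x) - f (snd x)) =
      measure_pmf.expectation \<mu> f - measure_pmf.expectation \<nu> f"
    if "\<rho> \<in> couplings \<mu> \<nu>" for \<rho>
  proof -
    have "map_pmf fst \<rho> = \<mu>" "map_pmf snd \<rho> = \<nu>" using that by (auto simp: couplings_def)
    then show ?thesis
      using fin'[OF that]
      by (auto simp: integrable_measure_pmf_finite simp flip: integral_map_pmf)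
  qed
  have lower: "measure_pmf.expectation \<mu> f - measure_pmf.expectation \<nu> f
      \<le> measure_pmf.expectation \<rho> ?d" if "\<rho> \<in> couplings \<mu> \<nu>" for \<rho>
    unfolding diff[OF that, symmetric] using fin'[OF that] lip
    by (intro integral_mono integrable_measure_pmf_finite) auto
  have eq: "measure_pmf.expectation \<pi> ?d =
      measure_pmf.expectation \<mu> f - measure_pmf.expectation \<nu> f"
    unfolding diff[OF \<pi>, symmetric] using tight
    by (intro integral_cong_AE) (auto simp: AE_measure_pmf_iff)
  have "wasserstein1 E \<mu> \<nu> = enn2real (transport_cost E \<pi>)"
    using \<pi> lower by (intro wasserstein1_eq_min) (auto simp: cost eq intro!: ennreal_leI)
  also have "\<dots> = measure_pmf.expectation \<pi> ?d"
    using \<pi> by (simp add: cost)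
  finally show ?thesis using eq by simp
qed

section \<open>The lazy walk on a regular tree\<close>

text \<open>The mass of a single vertex at distance \<open>r\<close>, not of the whole sphere. A
  vertex other than the start has one neighbor closer to the start and \<open>q\<close> further
  away.\<close>

primrec radial_prob :: "real \<Rightarrow> nat \<Rightarrow> nat \<Rightarrow> nat \<Rightarrow> real" where
  "radial_prob \<alpha> q 0 r = (if r = 0 then 1 else 0)"
| "radial_prob \<alpha> q (Suc n) r = \<alpha> * radial_prob \<alpha> q n r + (1 - \<alpha>) / (real q + 1) *
     (if r = 0 then (real q + 1) * radial_prob \<alpha> q n 1
      else radial_prob \<alpha> q n (r - 1) + real q * radial_prob \<alpha> q n (r + 1))"

text \<open>Without enough laziness, \<open>radial_prob \<alpha> q n\<close> is monotone only along steps of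
  length two, because of the parity of the walk.\<close>

lemma radial_prob_add2_le:
  assumes "0 \<le> \<alpha>" "\<alpha> \<le> 1"
  shows "radial_prob \<alpha> q n (r + 2) \<le> radial_prob \<alpha> q n r"
proof (induction n arbitrary: r)
  case (Suc n)
  let ?p = "radial_prob \<alpha> q n"
  have *: "0 \<le> (1 - \<alpha>) / (real q + 1)" using assms by simp
  have "?p (r + 1) + real q * ?p (r + 3) \<le>
      (if r = 0 then (real q + 1) * ?p 1 else ?p (r - 1) + real q * ?p (r + 1))"
  proof (cases "r = 0")
    \<comment> \<open>At the start one of the \<open>q + 1\<close> copies of \<open>?p 1\<close>
      matches \<open>?p (r + 1)\<close>, the other \<open>q\<close> dominate
      \<open>?p 3\<close>.\<close>
    case True
    have "real q * ?p 3 \<le> real q * ?p 1"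
      using Suc.IH[of 1] by (intro mult_left_mono) (auto simp: numeral_3_eq_3)
    then show ?thesis using True by (simp add: algebra_simps)
  next
    case False
    have "real q * ?p (r + 3) \<le> real q * ?p (r + 1)"
      using Suc.IH[of "r + 1"] by (intro mult_left_mono) (auto simp: eval_nat_numeral)
    then show ?thesis using False Suc.IH[of "r - 1"] by simp
  qed
  from mult_left_mono[OF this *] mult_left_mono[OF Suc.IH[of r] assms(1)]
  show ?case
    by (simp add: eval_nat_numeral)
qed auto

lemma radial_prob_mono:
  assumes "0 \<le> \<alpha>" "\<alpha> \<le> 1" "r \<le> r'" "even (r + r')"
  shows "radial_prob \<alpha> q n r' \<le> radial_prob \<alpha> q n r"
proof -
  obtain k where "r' = r + 2 * k"
    using assms(3,4) by (metis even_add even_diff_nat evenE le_add_diff_inverse)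
  moreover have "radial_prob \<alpha> q n (r + 2 * k) \<le> radial_prob \<alpha> q n r" for k
  proof (induction k)
    case (Suc k)
    then show ?case
      using radial_prob_add2_le[OF assms(1,2), of q n "r + 2 * k"] by (simp add: algebra_simps)
  qed auto
  ultimately show ?thesis by simp
qed

locale lazy_walk_tree = tree_graph E for E :: "'v \<Rightarrow> 'v \<Rightarrow> bool" +
  fixes q :: nat and \<alpha> :: real
  assumes regular: "regular_graph (q + 1) E" and q_ge_2: "q \<ge> 2"
    and alpha_nonneg: "0 \<le> \<alpha>" and alpha_less_1: "\<alpha> < 1"
begin

abbreviation N :: "'v \<Rightarrow> 'v set" where "N \<equiv> neighbors E"

abbreviation walk :: "'v \<Rightarrow> nat \<Rightarrow> 'v pmf" where "walk \<equiv> lazy_walk E \<alpha>"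

abbreviation \<beta> :: real where "\<beta> \<equiv> (1 - \<alpha>) / (real q + 1)"

lemma finite_neighbors [simp]: "finite (N v)" and card_neighbors [simp]: "card (N v) = q + 1"
  using regular by (auto simp: regular_graph_def)

lemma in_neighbors [simp]: "w \<in> N v \<longleftrightarrow> E v w"
  by (simp add: neighbors_def)

lemma pmf_step: "pmf (lazy_step E \<alpha> u) w = (if w = u then \<alpha> else if E u w then \<beta> else 0)"
  using pmf_lazy_step[of E q \<alpha> u w] tree regular alpha_nonneg alpha_less_1
  by (simp add: is_tree_def)

lemma set_step_subset: "set_pmf (lazy_step E \<alpha> v) \<subseteq> insert v (N v)"
  by (auto simp: set_pmf_iff pmf_step split: if_splits)

lemma expectation_step:
  fixes g :: "'v \<Rightarrow> real"
  shows "measure_pmf.expectation (lazy_step E \<alpha> v) g = \<alpha> * g v + \<beta> * (\<Sum>w\<in>N v. g w)"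
proof -
  have "measure_pmf.expectation (lazy_step E \<alpha> v) g =
      (\<Sum>w\<in>insert v (N v). pmf (lazy_step E \<alpha> v) w * g w)"
    using set_step_subset[of v]
    by (subst integral_measure_pmf[of "insert v (N v)"]) auto
  also have "\<dots> = \<alpha> * g v + (\<Sum>w\<in>N v. pmf (lazy_step E \<alpha> v) w * g w)"
    by (subst sum.insert) (auto simp: adj_irrefl pmf_step)
  also have "(\<Sum>w\<in>N v. pmf (lazy_step E \<alpha> v) w * g w) = (\<Sum>w\<in>N v. \<beta> * g w)"
    using adj_irrefl by (intro sum.cong) (auto simp: pmf_step)
  finally show ?thesis by (simp add: sum_distrib_left)
qed

lemma finite_set_walk [simp]: "finite (set_pmf (walk X n))"
proof (induction n)
  case (Suc n)
  have "finite (set_pmf (lazy_step E \<alpha> v))" for v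
    using set_step_subset[of v] by (rule finite_subset) auto
  with Suc show ?case by auto
qed auto

lemma integrable_walk [simp]: "integrable (measure_pmf (walk X n)) (g :: 'v \<Rightarrow> real)"
  by (rule integrable_measure_pmf_finite) simp

lemma expectation_walk_Suc:
  fixes g :: "'v \<Rightarrow> real"
  shows "measure_pmf.expectation (walk X (Suc n)) g =
    measure_pmf.expectation (walk X n) (\<lambda>v. measure_pmf.expectation (lazy_step E \<alpha> v) g)"
proof -
  have "finite (set_pmf (lazy_step E \<alpha> v))" for v
    using set_step_subset[of v] by (rule finite_subset) auto
  then have "measure_pmf.expectation (walk X (Suc n)) g = (\<Sum>v\<in>set_pmf (walk X n).
      pmf (walk X n) v *\<^sub>R measure_pmf.expectation (lazy_step E \<alpha> v) g)"
    by (simp add: pmf_expectation_bind[of "set_pmf (walk X n)"])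
  then show ?thesis
    by (subst integral_measure_pmf[of "set_pmf (walk X n)"]) auto
qed

lemma pmf_walk_Suc:
  "pmf (walk X (Suc n)) w = \<alpha> * pmf (walk X n) w + \<beta> * (\<Sum>v\<in>N w. pmf (walk X n) v)"
proof -
  have "pmf (walk X (Suc n)) w =
      measure_pmf.expectation (walk X n) (\<lambda>v. pmf (lazy_step E \<alpha> v) w)"
    by (simp add: pmf_bind)
  also have "\<dots> = (\<Sum>v\<in>insert w (N w). pmf (walk X n) v * pmf (lazy_step E \<alpha> v) w)"
    using adj_sym by (subst integral_measure_pmf[of "insert w (N w)"])
      (auto simp: pmf_step split: if_splits)
  also have "\<dots> = \<alpha> * pmf (walk X n) w + (\<Sum>v\<in>N w. pmf (walk X n) v * pmf (lazy_step E \<alpha> v) w)"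
    by (subst sum.insert) (auto simp: adj_irrefl pmf_step)
  also have "(\<Sum>v\<in>N w. pmf (walk X n) v * pmf (lazy_step E \<alpha> v) w) =
      (\<Sum>v\<in>N w. \<beta> * pmf (walk X n) v)"
    using adj_irrefl adj_sym by (intro sum.cong) (auto simp: pmf_step)
  finally show ?thesis by (simp add: sum_distrib_left)
qed

lemma neighbors_split:
  assumes "v \<noteq> u"
  obtains w where "E v w" "D v u = D w u + 1"
    "\<And>w'. w' \<in> N v - {w} \<Longrightarrow> D w' u = D v u + 1" "card (N v - {w}) = q"
proof -
  obtain w where w: "E v w" "D v u = D w u + 1"
    using ex_closer_neighbor[OF assms] by blast
  moreover have "D w' u = D v u + 1" if "w' \<in> N v - {w}" for w'
    using that closer_neighbor_unique[of v w w' u] dist_neighbor_cases[of v w' u] w by auto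
  ultimately show ?thesis
    by (intro that[of w]) auto
qed

lemma pmf_walk: "pmf (walk X n) v = radial_prob \<alpha> q n (D v X)"
proof (induction n arbitrary: v)
  case 0
  then show ?case by (auto simp: indicator_def)
next
  case (Suc n)
  let ?p = "radial_prob \<alpha> q n"
  have "(\<Sum>w\<in>N v. ?p (D w X)) =
    (if D v X = 0 then (real q + 1) * ?p 1 else ?p (D v X - 1) + real q * ?p (D v X + 1))"
  proof (cases "v = X")
    case True
    then have "(\<Sum>w\<in>N v. ?p (D w X)) = (\<Sum>w\<in>N v. ?p 1)"
      by (intro sum.cong) (auto simp: dist_adj adj_sym)
    then show ?thesis using True by simp
  next
    case False
    then obtain w where w: "E v w" "D v X = D w X + 1"
      "\<And>w'. w' \<in> N v - {w} \<Longrightarrow> D w' X = D v X + 1" "card (N v - {w}) = q"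
      using neighbors_split by blast
    have "(\<Sum>w\<in>N v. ?p (D w X)) = ?p (D w X) + (\<Sum>w\<in>N v - {w}. ?p (D w X))"
      using w(1) by (intro sum.remove) auto
    also have "(\<Sum>w\<in>N v - {w}. ?p (D w X)) = (\<Sum>w\<in>N v - {w}. ?p (D v X + 1))"
      using w(3) by (intro sum.cong) auto
    finally show ?thesis using w(2,4) False by simp
  qed
  then show ?case
    unfolding pmf_walk_Suc Suc.IH by simp
qed

section \<open>The potential and the optimal coupling\<close>

text \<open>For \<open>v\<close> nearer to \<open>X\<close> the geodesic to \<open>Y\<close> crosses
  the midpoint, so \<open>D v Y\<close> determines the distance from it. A middle vertex and the
  branches hanging off it get 0.\<close>

definition odd_ext :: "'v \<Rightarrow> 'v \<Rightarrow> (nat \<Rightarrow> real) \<Rightarrow> 'v \<Rightarrow> real" where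
  "odd_ext X Y \<phi> v =
     (if D v X < D v Y then \<phi> (D v Y) else if D v Y < D v X then - \<phi> (D v X) else 0)"

lemma odd_ext_swap: "odd_ext Y X \<phi> v = - odd_ext X Y \<phi> v"
  by (auto simp: odd_ext_def)

abbreviation potential :: "'v \<Rightarrow> 'v \<Rightarrow> 'v \<Rightarrow> real" where
  "potential X Y \<equiv> odd_ext X Y (\<lambda>r. real r - real (D X Y) / 2)"

text \<open>On a common side this is the triangle inequality at the far endpoint; from the side of
  \<open>X\<close> to that of \<open>Y\<close>, \<open>four_point\<close> gives equality. In the
  reverse order the difference is nonpositive, as the larger distance is at least
  \<open>D X Y / 2\<close>.\<close>

lemma potential_lipschitz: "potential X Y v - potential X Y w \<le> real (D v w)"
proof -
  have "D v X + D w Y < D v Y + D w X \<Longrightarrow> D v w + D X Y = D v Y + D w X"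
    by (rule four_point)
  moreover have "D X Y \<le> D v X + D v Y" "D X Y \<le> D w X + D w Y"
    using dist_triangle[of X Y v] dist_triangle[of X Y w]
    by (simp_all add: dist_commute[of X v] dist_commute[of X w])
  moreover have "D v Y \<le> D v w + D w Y" "D w X \<le> D v w + D v X"
    using dist_triangle[of v Y w] dist_triangle[of w X v] by (simp_all add: dist_commute[of w v])
  ultimately show ?thesis
    unfolding odd_ext_def
    by (cases "D v X" "D v Y" rule: linorder_cases; cases "D w X" "D w Y" rule: linorder_cases)
      (simp_all; linarith)+
qed

lemma potential_tight:
  assumes "D v X < D v Y" "D w Y < D w X"
  shows "real (D v w) = potential X Y v - potential X Y w"
proof -
  have "D v w + D X Y = D v Y + D w X"
    using assms by (intro four_point) auto
  then show ?thesis using assms by (simp add: odd_ext_def field_simps flip: of_nat_add)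
qed

text \<open>For odd distance, the mass of the walk from \<open>Y\<close> at a vertex \<open>w\<close> closer to \<open>X\<close> is
  supplied in equal parts by the \<open>q\<close> neighbors of \<open>w\<close> further away from \<open>Y\<close>, and
  symmetrically with \<open>X\<close> and \<open>Y\<close> exchanged.\<close>

definition shift_plan :: "'v \<Rightarrow> 'v \<Rightarrow> nat \<Rightarrow> 'v \<Rightarrow> 'v \<Rightarrow> real" where
  "shift_plan X Y n v w =
     (if E v w \<and> D w X < D w Y \<and> D v Y = D w Y + 1 then pmf (walk Y n) w / real q
      else if E v w \<and> D v Y < D v X \<and> D w X = D v X + 1 then pmf (walk X n) v / real q
      else 0)"

text \<open>The exchange interchanges the two clauses. Their order is harmless: the first forces
  \<open>v\<close> to be nearer to \<open>X\<close>, the second to \<open>Y\<close>.\<close>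

lemma shift_plan_swap: "shift_plan X Y n v w = shift_plan Y X n w v"
proof -
  have "\<not> D v Y < D v X" if "E v w" "D w X < D w Y" "D v Y = D w Y + 1"
    using that dist_adj_le[of w v X] adj_sym[of v w] by auto
  moreover have "E v w \<longleftrightarrow> E w v" using adj_sym by blast
  ultimately show ?thesis
    unfolding shift_plan_def by simp
qed

text \<open>The \<open>q\<close> neighbors of \<open>v\<close> away from \<open>X\<close> receive
  all of its mass in equal shares. The disjunction admits massless vertices whose neighbors may
  leave \<open>S\<close>.\<close>

lemma shift_plan_row_eq:
  assumes "D v Y < D v X" "N v \<subseteq> S \<or> pmf (walk X n) v = 0" "finite S"
  shows "(\<Sum>w\<in>S. shift_plan X Y n v w) = pmf (walk X n) v"
proof -
  have *: "shift_plan X Y n v w =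
      (if E v w \<and> D w X = D v X + 1 then pmf (walk X n) v / real q else 0)" for w
    using assms(1) dist_adj_le[of w v X] adj_sym[of v w] unfolding shift_plan_def by auto
  show ?thesis
  proof (cases "pmf (walk X n) v = 0")
    case False
    have "v \<noteq> X" using assms(1) by auto
    then obtain w where w: "E v w" "D v X = D w X + 1"
      "\<And>w'. w' \<in> N v - {w} \<Longrightarrow> D w' X = D v X + 1" "card (N v - {w}) = q"
      using neighbors_split by blast
    have "w' \<in> S \<and> E v w' \<and> D w' X = D v X + 1 \<longleftrightarrow> w' \<in> N v - {w}" for w'
      using assms(2) False w(2) w(3)[of w'] by auto
    then have "{w' \<in> S. E v w' \<and> D w' X = D v X + 1} = N v - {w}"
      by blast
    then show ?thesis
      using assms(3) w(4) q_ge_2 by (simp add: * sum.If_cases Int_def conj_commute)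
  qed (auto simp: * intro: sum.neutral)
qed

lemma shift_plan_nonneg: "0 \<le> shift_plan X Y n v w"
  by (simp add: shift_plan_def)

text \<open>Such a \<open>v\<close> supplies at most its one neighbor \<open>w\<close> towards
  \<open>Y\<close>. As \<open>D v X \<le> D w Y\<close> with equal parity, the demand of
  \<open>w\<close> is bounded by the mass at \<open>v\<close>.\<close>

lemma shift_plan_row_le:
  assumes "D v X < D v Y" "finite S" "odd (D X Y)"
  shows "(\<Sum>w\<in>S. shift_plan X Y n v w) \<le> pmf (walk X n) v"
proof -
  have "v \<noteq> Y" using assms(1) by auto
  then obtain w where w: "E v w" "D v Y = D w Y + 1"
    "\<And>w'. w' \<in> N v - {w} \<Longrightarrow> D w' Y = D v Y + 1" "card (N v - {w}) = q"
    using neighbors_split by blast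
  have *: "shift_plan X Y n v w' \<le> (if w' = w then pmf (walk X n) v else 0)" for w'
  proof (cases "E v w' \<and> D v Y = D w' Y + 1")
    case True
    then have "w' = w" using w(3)[of w'] by auto
    have "even (D w Y + D v X)"
      using even_dist_sum[of v X Y] assms(3) w(2) by auto
    then have "pmf (walk Y n) w \<le> pmf (walk X n) v"
      unfolding pmf_walk using assms(1) w(2) alpha_nonneg alpha_less_1
      by (intro radial_prob_mono) (auto simp: add.commute)
    moreover have "pmf (walk Y n) w / real q \<le> pmf (walk Y n) w"
      using q_ge_2 mult_left_mono[of 1 "real q" "pmf (walk Y n) w"] by (simp add: divide_le_eq)
    ultimately show ?thesis
      using \<open>w' = w\<close> assms(1) by (auto simp: shift_plan_def)
  next
    case False
    then have "shift_plan X Y n v w' = 0"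
      unfolding shift_plan_def using assms(1) by (simp, blast)
    then show ?thesis by simp
  qed
  have "(\<Sum>w'\<in>S. shift_plan X Y n v w') \<le> (\<Sum>w'\<in>S. if w' = w then pmf (walk X n) v else 0)"
    by (rule sum_mono) (rule *)
  also have "\<dots> \<le> pmf (walk X n) v" using assms(2) by simp
  finally show ?thesis .
qed

lemma shift_plan_tight:
  assumes "shift_plan X Y n v w > 0"
  shows "real (D v w) = potential X Y v - potential X Y w"
proof -
  consider "E v w" "D w X < D w Y" "D v Y = D w Y + 1" | "E v w" "D v Y < D v X" "D w X = D v X + 1"
    using assms by (auto simp: shift_plan_def split: if_splits)
  then show ?thesis
  proof cases
    case 1
    then have "D v X < D v Y" using dist_adj_le[of w v X] adj_sym[of v w] by simp
    then show ?thesis using 1 dist_adj[OF 1(1)] by (simp add: odd_ext_def)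
  next
    case 2
    then have "D w Y < D w X" using dist_adj_le[of v w Y] by simp
    then show ?thesis using 2 dist_adj[OF 2(1)] by (simp add: odd_ext_def)
  qed
qed

lemma wasserstein1_walk_odd:
  assumes "odd (D X Y)"
  shows "wasserstein1 E (walk X n) (walk Y n) =
    measure_pmf.expectation (walk X n) (potential X Y) -
    measure_pmf.expectation (walk Y n) (potential X Y)"
proof -
  define T where "T = set_pmf (walk X n) \<union> set_pmf (walk Y n)"
  \<comment> \<open>Neighbors are included so that \<open>shift_plan_row_eq\<close> applies wherever
    there is mass.\<close>
  define S where "S = T \<union> (\<Union>v\<in>T. N v)"
  have S: "finite S" "set_pmf (walk X n) \<subseteq> S" "set_pmf (walk Y n) \<subseteq> S"
    by (auto simp: S_def T_def)
  have NX: "N v \<subseteq> S \<or> pmf (walk X n) v = 0" and NY: "N v \<subseteq> S \<or> pmf (walk Y n) v = 0" for v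
    by (auto simp: S_def T_def set_pmf_iff)
  have ne: "D v X \<noteq> D v Y" for v
    using even_dist_sum[of v X Y] assms by auto
  have row: "(\<Sum>w\<in>S. shift_plan X Y n v w) \<le> pmf (walk X n) v" for v
    using shift_plan_row_eq[of v Y X S n] shift_plan_row_le[of v X Y S n] NX[of v] S(1) assms ne[of v]
    by (cases "D v X < D v Y") auto
  have odd': "odd (D Y X)" using assms by (simp add: dist_commute)
  have col: "(\<Sum>v\<in>S. shift_plan X Y n v w) \<le> pmf (walk Y n) w" for w
    unfolding shift_plan_swap[of X Y]
    using shift_plan_row_eq[of w X Y S n] shift_plan_row_le[of w Y X S n] NY[of w] S(1) odd' ne[of w]
    by (cases "D w Y < D w X") auto
  obtain \<pi> where \<pi>: "\<pi> \<in> couplings (walk X n) (walk Y n)"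
    and supp: "\<And>v w. (v, w) \<in> set_pmf \<pi> \<Longrightarrow> shift_plan X Y n v w > 0 \<or> (v \<in> S \<and> w \<in> S \<and>
      (\<Sum>w\<in>S. shift_plan X Y n v w) < pmf (walk X n) v \<and>
      (\<Sum>v\<in>S. shift_plan X Y n v w) < pmf (walk Y n) w)"
    using coupling_extension[OF S shift_plan_nonneg row col] by blast
  show ?thesis
  proof (rule wasserstein1_eq_potential[OF _ _ potential_lipschitz \<pi>])
    fix v w assume "(v, w) \<in> set_pmf \<pi>"
    from supp[OF this] show "real (D v w) = potential X Y v - potential X Y w"
    proof
      assume *: "v \<in> S \<and> w \<in> S \<and> (\<Sum>w\<in>S. shift_plan X Y n v w) < pmf (walk X n) v \<and>
        (\<Sum>v\<in>S. shift_plan X Y n v w) < pmf (walk Y n) w"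
      \<comment> \<open>Leftover mass of the walk from \<open>X\<close> cannot lie nearer to
        \<open>Y\<close>, where \<open>shift_plan\<close> exhausts the rows; likewise for
        columns.\<close>
      have "D v X < D v Y"
        using shift_plan_row_eq[OF _ NX S(1), of v Y] * ne[of v] by force
      moreover have "D w Y < D w X"
        using shift_plan_row_eq[OF _ NY S(1), of w X] * ne[of w]
        unfolding shift_plan_swap[of X Y] by force
      ultimately show ?thesis by (rule potential_tight)
    qed (rule shift_plan_tight)
  qed auto
qed

text \<open>The distances of a vertex to \<open>X\<close> and \<open>Y\<close> have equal parity, so
  the nearer start contributes at least as much mass. Keeping the common minimum in place leaves
  each walk an excess only on its own side.\<close>

lemma wasserstein1_walk_even:
  assumes "even (D X Y)"
  shows "wasserstein1 E (walk X n) (walk Y n) =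
    measure_pmf.expectation (walk X n) (potential X Y) -
    measure_pmf.expectation (walk Y n) (potential X Y)"
proof -
  define S where "S = set_pmf (walk X n) \<union> set_pmf (walk Y n)"
  define m where "m v = min (pmf (walk X n) v) (pmf (walk Y n) v)" for v
  define \<kappa> where "\<kappa> v w = (if v = w then m v else 0)" for v w
  have S: "finite S" "set_pmf (walk X n) \<subseteq> S" "set_pmf (walk Y n) \<subseteq> S"
    by (auto simp: S_def)
  have sums: "(\<Sum>w\<in>S. \<kappa> v w) = m v" "(\<Sum>w\<in>S. \<kappa> w v) = m v" if "v \<in> S" for v
    using that S(1) by (auto simp: \<kappa>_def)
  have nonneg: "0 \<le> \<kappa> v w" for v w by (simp add: \<kappa>_def m_def)
  have row: "(\<Sum>w\<in>S. \<kappa> v w) \<le> pmf (walk X n) v" if "v \<in> S" for v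
    using sums(1)[OF that] by (simp add: m_def)
  have col: "(\<Sum>v\<in>S. \<kappa> v w) \<le> pmf (walk Y n) w" if "w \<in> S" for w
    using sums(2)[OF that] by (simp add: m_def)
  obtain \<pi> where \<pi>: "\<pi> \<in> couplings (walk X n) (walk Y n)"
    and supp: "\<And>v w. (v, w) \<in> set_pmf \<pi> \<Longrightarrow> \<kappa> v w > 0 \<or> (v \<in> S \<and> w \<in> S \<and>
      (\<Sum>w\<in>S. \<kappa> v w) < pmf (walk X n) v \<and> (\<Sum>v\<in>S. \<kappa> v w) < pmf (walk Y n) w)"
    using coupling_extension[OF S nonneg row col] by blast
  have less: "D v Z < D v Z'" if "pmf (walk Z' n) v < pmf (walk Z n) v" "even (D Z Z')" for v Z Z'
  proof (rule ccontr)
    assume "\<not> D v Z < D v Z'"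
    then have "pmf (walk Z n) v \<le> pmf (walk Z' n) v"
      unfolding pmf_walk using even_dist_sum[of v Z Z'] that(2) alpha_nonneg alpha_less_1
      by (intro radial_prob_mono) auto
    with that show False by simp
  qed
  show ?thesis
  proof (rule wasserstein1_eq_potential[OF _ _ potential_lipschitz \<pi>])
    fix v w assume "(v, w) \<in> set_pmf \<pi>"
    from supp[OF this] show "real (D v w) = potential X Y v - potential X Y w"
    proof
      assume "\<kappa> v w > 0"
      then show ?thesis by (simp add: \<kappa>_def split: if_splits)
    next
      assume "v \<in> S \<and> w \<in> S \<and> (\<Sum>w\<in>S. \<kappa> v w) < pmf (walk X n) v \<and>
        (\<Sum>v\<in>S. \<kappa> v w) < pmf (walk Y n) w"
      then have "m v < pmf (walk X n) v" "m w < pmf (walk Y n) w"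
        using sums by auto
      then have "D v X < D v Y" "D w Y < D w X"
        using less[of Y v X] less[of X w Y] assms dist_commute[of X Y] by (auto simp: m_def)
      then show ?thesis by (rule potential_tight)
    qed
  qed auto
qed

lemma wasserstein1_walk:
  "wasserstein1 E (walk X n) (walk Y n) =
    measure_pmf.expectation (walk X n) (potential X Y) -
    measure_pmf.expectation (walk Y n) (potential X Y)"
  using wasserstein1_walk_odd wasserstein1_walk_even by blast

section \<open>Expectation of the potential\<close>

text \<open>The hypothesis on \<open>\<phi>\<close> says that the value of \<open>odd_ext\<close> just across the midpoint
  is the one obtained by continuing \<open>\<phi>\<close>. For even distance it reads \<open>\<phi> (d / 2) = 0\<close>.\<close>

lemma sum_odd_ext_near:
  assumes bal: "\<phi> (D X Y div 2) + \<phi> (D X Y - D X Y div 2) = 0" and v: "D v X < D v Y"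
  shows "(\<Sum>w\<in>N v. odd_ext X Y \<phi> w) = real q * \<phi> (D v Y + 1) + \<phi> (D v Y - 1)"
proof -
  have "v \<noteq> Y" using v by auto
  then obtain w where w: "E v w" "D v Y = D w Y + 1"
    "\<And>w'. w' \<in> N v - {w} \<Longrightarrow> D w' Y = D v Y + 1" "card (N v - {w}) = q"
    using neighbors_split by blast
  have "odd_ext X Y \<phi> w' = \<phi> (D v Y + 1)" if "w' \<in> N v - {w}" for w'
    using w(3)[OF that] dist_adj_le[of v w' X] that v by (auto simp: odd_ext_def)
  then have "(\<Sum>w'\<in>N v - {w}. odd_ext X Y \<phi> w') = real q * \<phi> (D v Y + 1)"
    using w(4) by simp
  moreover have "odd_ext X Y \<phi> w = \<phi> (D v Y - 1)"
  proof -
    have four: "1 + D X Y = D v Y + D w X" if "D w Y \<le> D w X"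
      using four_point[of v X w Y] dist_adj[OF w(1)] v that by simp
    \<comment> \<open>In the first case the edge stays on the side of \<open>X\<close>. Otherwise
      \<open>four\<close> gives \<open>D w Y = D X Y div 2\<close>, and \<open>bal\<close>
      identifies the value at \<open>w\<close>.\<close>
    consider "D w X < D w Y" | "D w X = D w Y" | "D w Y < D w X" by linarith
    then show ?thesis
    proof cases
      case 1
      then show ?thesis using w(2) by (simp add: odd_ext_def)
    next
      case 2
      then have "D X Y = 2 * D w Y" using four w(2) by simp
      then show ?thesis using 2 w(2) bal by (simp add: odd_ext_def)
    next
      case 3
      then have "D w X = D w Y + 1" using dist_adj_le[OF w(1), of X] v w(2) by simp
      moreover from this have "D X Y = 2 * D w Y + 1" using four w(2) by simp
      ultimately show ?thesis using w(2) bal by (simp add: odd_ext_def)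
    qed
  qed
  moreover have "(\<Sum>w'\<in>N v. odd_ext X Y \<phi> w') =
      odd_ext X Y \<phi> w + (\<Sum>w'\<in>N v - {w}. odd_ext X Y \<phi> w')"
    using w(1) by (intro sum.remove) auto
  ultimately show ?thesis by simp
qed

text \<open>At a middle vertex the neighbors towards \<open>X\<close> and \<open>Y\<close> have
  opposite values; elsewhere both directions share one neighbor, again equidistant. The remaining
  neighbors have value 0.\<close>

lemma sum_odd_ext_equidistant:
  assumes "X \<noteq> Y" and v: "D v X = D v Y"
  shows "(\<Sum>w\<in>N v. odd_ext X Y \<phi> w) = 0"
proof -
  have "v \<noteq> X" "v \<noteq> Y" using assms by auto
  obtain w where w: "E v w" "D v X = D w X + 1"
    "\<And>w'. w' \<in> N v - {w} \<Longrightarrow> D w' X = D v X + 1" "card (N v - {w}) = q"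
    using neighbors_split[OF \<open>v \<noteq> X\<close>] by blast
  obtain u where u: "E v u" "D v Y = D u Y + 1"
    "\<And>w'. w' \<in> N v - {u} \<Longrightarrow> D w' Y = D v Y + 1" "card (N v - {u}) = q"
    using neighbors_split[OF \<open>v \<noteq> Y\<close>] by blast
  have rest: "odd_ext X Y \<phi> x = 0" if "x \<in> N v - {w, u}" for x
    using w(3)[of x] u(3)[of x] that v by (simp add: odd_ext_def)
  show ?thesis
  proof (cases "w = u")
    case True
    then have "odd_ext X Y \<phi> w = 0" using w(2) u(2) v by (simp add: odd_ext_def)
    then show ?thesis using rest True by (intro sum.neutral) blast
  next
    case False
    have "odd_ext X Y \<phi> w = \<phi> (D v Y + 1)" "odd_ext X Y \<phi> u = - \<phi> (D v X + 1)"
      using w(2) u(2) u(3)[of w] w(3)[of u] w(1) u(1) False v by (auto simp: odd_ext_def)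
    moreover have "(\<Sum>x\<in>N v. odd_ext X Y \<phi> x) = (\<Sum>x\<in>{w, u}. odd_ext X Y \<phi> x)"
      using w(1) u(1) rest by (intro sum.mono_neutral_right) auto
    ultimately show ?thesis using False v by simp
  qed
qed

lemma sum_odd_ext:
  assumes "X \<noteq> Y" and bal: "\<phi> (D X Y div 2) + \<phi> (D X Y - D X Y div 2) = 0"
  shows "(\<Sum>w\<in>N v. odd_ext X Y \<phi> w) = odd_ext X Y (\<lambda>r. real q * \<phi> (r + 1) + \<phi> (r - 1)) v"
proof -
  consider "D v X < D v Y" | "D v X = D v Y" | "D v Y < D v X" by linarith
  then show ?thesis
  proof cases
    case 1
    then show ?thesis using sum_odd_ext_near[of \<phi> X Y v] bal by (simp add: odd_ext_def)
  next
    case 2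
    then show ?thesis using sum_odd_ext_equidistant[OF assms(1) 2, of \<phi>]
      by (simp add: odd_ext_def)
  next
    case 3
    have "(\<Sum>w\<in>N v. odd_ext Y X \<phi> w) = real q * \<phi> (D v X + 1) + \<phi> (D v X - 1)"
      using sum_odd_ext_near[of \<phi> Y X v] bal 3 by (simp add: dist_commute[of Y X])
    then show ?thesis
      using 3 unfolding odd_ext_swap[of Y X] sum_negf by (simp add: odd_ext_def)
  qed
qed

text \<open>The argument is the larger of two different distances, hence positive. This confines the
  radial equations to \<open>r > 0\<close>, where \<open>r - 1\<close> is not truncated.\<close>

lemma odd_ext_cong:
  assumes "\<And>r. r > 0 \<Longrightarrow> \<phi> r = \<psi> r"
  shows "odd_ext X Y \<phi> v = odd_ext X Y \<psi> v"
  using assms by (auto simp: odd_ext_def)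

lemma expectation_step_odd_ext:
  assumes "X \<noteq> Y" and bal: "\<phi> (D X Y div 2) + \<phi> (D X Y - D X Y div 2) = 0"
    and lap: "\<And>r. r > 0 \<Longrightarrow>
      real q * \<phi> (r + 1) + \<phi> (r - 1) = (real q + 1) * \<phi> r + c * \<psi> r"
  shows "measure_pmf.expectation (lazy_step E \<alpha> v) (odd_ext X Y \<phi>) =
    odd_ext X Y \<phi> v + \<beta> * c * odd_ext X Y \<psi> v"
proof -
  have "(\<Sum>w\<in>N v. odd_ext X Y \<phi> w) = odd_ext X Y (\<lambda>r. (real q + 1) * \<phi> r + c * \<psi> r) v"
    unfolding sum_odd_ext[OF assms(1,2)] by (rule odd_ext_cong) (rule lap)
  also have "\<dots> = (real q + 1) * odd_ext X Y \<phi> v + c * odd_ext X Y \<psi> v"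
    by (auto simp: odd_ext_def)
  finally show ?thesis
    unfolding expectation_step by (simp add: field_simps)
qed

section \<open>Harmonic and corrected radial functions\<close>

abbreviation z :: real where "z \<equiv> 1 / real q"

text \<open>The coefficient and the center are forced by \<open>harm_fun_balanced\<close> and
  \<open>corr_fun_balanced\<close>, which make \<open>odd_ext\<close> of these functions satisfy the same recursion
  across the midpoint as away from it.\<close>

definition harm_coeff :: "nat \<Rightarrow> real" where
  "harm_coeff d = 2 / (z ^ (d div 2) + z ^ (d - d div 2))"

definition corr_center :: "nat \<Rightarrow> real" where
  "corr_center d =
    (real (d div 2) * z ^ (d div 2) + real (d - d div 2) * z ^ (d - d div 2)) /
    (z ^ (d div 2) + z ^ (d - d div 2))"

text \<open>Both \<open>1\<close> and \<open>z ^ r\<close> solve the radial harmonic equation; this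
  combination tends to 1 and is balanced across the midpoint.\<close>

definition harm_fun :: "nat \<Rightarrow> nat \<Rightarrow> real" where
  "harm_fun d r = 1 - harm_coeff d * z ^ r"

definition corr_fun :: "nat \<Rightarrow> nat \<Rightarrow> real" where
  "corr_fun d r = harm_coeff d * (real r - corr_center d) * z ^ r"

lemma z_pow_pos: "0 < z ^ r"
  using q_ge_2 by simp

lemma harm_fun_balanced: "harm_fun d (d div 2) + harm_fun d (d - d div 2) = 0"
proof -
  define t where "t = z ^ (d div 2) + z ^ (d - d div 2)"
  have "t > 0"
    using z_pow_pos[of "d div 2"] z_pow_pos[of "d - d div 2"] unfolding t_def by linarith
  then have "harm_coeff d * t = 2"
    unfolding harm_coeff_def t_def[symmetric] by simp
  then show ?thesis by (simp add: harm_fun_def t_def algebra_simps)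
qed

lemma corr_fun_balanced: "corr_fun d (d div 2) + corr_fun d (d - d div 2) = 0"
proof -
  have "z ^ (d div 2) + z ^ (d - d div 2) \<noteq> 0"
    using z_pow_pos[of "d div 2"] z_pow_pos[of "d - d div 2"] by linarith
  moreover have "corr_fun d (d div 2) + corr_fun d (d - d div 2) = harm_coeff d *
      (real (d div 2) * z ^ (d div 2) + real (d - d div 2) * z ^ (d - d div 2)
        - corr_center d * (z ^ (d div 2) + z ^ (d - d div 2)))"
    unfolding corr_fun_def by (simp only: algebra_simps)
  ultimately show ?thesis by (simp add: corr_center_def)
qed

lemma harm_fun_laplacian:
  assumes "r > 0"
  shows "real q * harm_fun d (r + 1) + harm_fun d (r - 1) = (real q + 1) * harm_fun d r"
proof -
  obtain k where "r = Suc k" using assms by (cases r) auto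
  then show ?thesis using q_ge_2 unfolding harm_fun_def by (simp add: field_simps)
qed

text \<open>The radial Laplacian sends \<open>r * z ^ r\<close> to \<open>- (q - 1) * z ^ r\<close>
  and kills \<open>z ^ r\<close>, which leaves \<open>corr_center\<close> free for
  balancing.\<close>

lemma corr_fun_laplacian:
  assumes "r > 0"
  shows "real q * corr_fun d (r + 1) + corr_fun d (r - 1) =
    (real q + 1) * corr_fun d r + (real q - 1) * (harm_fun d r - 1)"
proof -
  obtain k where "r = Suc k" using assms by (cases r) auto
  then show ?thesis using q_ge_2 unfolding corr_fun_def harm_fun_def by (simp add: field_simps)
qed

text \<open>The Laplacian of \<open>r - d / 2\<close> is the constant \<open>q - 1\<close>; the
  correction turns it into the harmonic \<open>(q - 1) * harm_fun d r\<close>.\<close>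

definition exact_fun :: "nat \<Rightarrow> nat \<Rightarrow> real" where
  "exact_fun d r = (real r - real d / 2) + corr_fun d r"

lemma exact_fun_balanced: "exact_fun d (d div 2) + exact_fun d (d - d div 2) = 0"
proof -
  have "real (d div 2) + real (d - d div 2) = real d"
    by (simp flip: of_nat_add)
  then show ?thesis using corr_fun_balanced[of d] by (simp add: exact_fun_def)
qed

lemma exact_fun_laplacian:
  assumes "r > 0"
  shows "real q * exact_fun d (r + 1) + exact_fun d (r - 1) =
    (real q + 1) * exact_fun d r + (real q - 1) * harm_fun d r"
proof -
  have "real (r - 1) = real r - 1" using assms by simp
  then show ?thesis
    using corr_fun_laplacian[OF assms, of d] by (simp add: exact_fun_def algebra_simps add_divide_distrib)
qed

text \<open>The first expectation is conserved and, times \<open>\<beta> * (real q - 1)\<close>, is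
  the increment of the second. At time 0 the walk is at \<open>X\<close>, where the argument is
  \<open>D X Y\<close>.\<close>

lemma expectation_exact:
  assumes "X \<noteq> Y"
  shows "measure_pmf.expectation (walk X n) (odd_ext X Y (harm_fun (D X Y))) = harm_fun (D X Y) (D X Y)"
    and "measure_pmf.expectation (walk X n) (odd_ext X Y (exact_fun (D X Y))) =
      exact_fun (D X Y) (D X Y) + \<beta> * (real q - 1) * real n * harm_fun (D X Y) (D X Y)"
proof -
  let ?d = "D X Y"
  have d: "?d > 0" using assms by (simp add: neq0_conv[symmetric] del: neq0_conv)
  show *: "measure_pmf.expectation (walk X n) (odd_ext X Y (harm_fun ?d)) = harm_fun ?d ?d" for n
  proof (induction n)
    case 0
    then show ?case using d by (simp add: odd_ext_def)
  next
    case (Suc n)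
    have "measure_pmf.expectation (lazy_step E \<alpha> v) (odd_ext X Y (harm_fun ?d)) =
        odd_ext X Y (harm_fun ?d) v" for v
      using expectation_step_odd_ext[OF assms harm_fun_balanced, of 0 "\<lambda>_. 0"] harm_fun_laplacian
      by simp
    then show ?case unfolding expectation_walk_Suc using Suc by simp
  qed
  show "measure_pmf.expectation (walk X n) (odd_ext X Y (exact_fun ?d)) =
      exact_fun ?d ?d + \<beta> * (real q - 1) * real n * harm_fun ?d ?d"
  proof (induction n)
    case 0
    then show ?case using d by (simp add: odd_ext_def)
  next
    case (Suc n)
    have "measure_pmf.expectation (lazy_step E \<alpha> v) (odd_ext X Y (exact_fun ?d)) =
        odd_ext X Y (exact_fun ?d) v + \<beta> * (real q - 1) * odd_ext X Y (harm_fun ?d) v" for v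
      by (rule expectation_step_odd_ext[OF assms exact_fun_balanced exact_fun_laplacian])
    then have "measure_pmf.expectation (walk X (Suc n)) (odd_ext X Y (exact_fun ?d)) =
        measure_pmf.expectation (walk X n) (odd_ext X Y (exact_fun ?d)) +
        \<beta> * (real q - 1) * measure_pmf.expectation (walk X n) (odd_ext X Y (harm_fun ?d))"
      unfolding expectation_walk_Suc by simp
    moreover define k where "k = \<beta> * (real q - 1)"
    ultimately show ?case
      unfolding k_def[symmetric] Suc * by (simp add: algebra_simps)
  qed
qed

section \<open>Geometric decay of the correction term\<close>

abbreviation s :: real where "s \<equiv> 1 / sqrt (real q)"

text \<open>The choice of \<open>s\<close> minimizes \<open>q * s + 1 / s\<close>, with value
  \<open>2 * sqrt q\<close>; thus \<open>\<rho>\<close> is the spectral radius of the lazy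
  walk.\<close>

abbreviation \<rho> :: real where "\<rho> \<equiv> \<alpha> + \<beta> * (2 * sqrt (real q))"

lemma rho_bounds: "0 \<le> \<rho>" "\<rho> < 1"
proof -
  show "0 \<le> \<rho>" using alpha_nonneg alpha_less_1 by simp
  have "sqrt (real q) \<noteq> 1" using q_ge_2 by simp
  then have "0 < (sqrt (real q) - 1)\<^sup>2" by simp
  then have "2 * sqrt (real q) < real q + 1"
    by (simp add: power2_eq_square algebra_simps)
  moreover have "\<beta> > 0" using alpha_less_1 by simp
  ultimately have "\<beta> * (2 * sqrt (real q)) < \<beta> * (real q + 1)"
    by (rule mult_strict_left_mono)
  also have "\<dots> = 1 - \<alpha>" by simp
  finally show "\<rho> < 1" by simp
qed

text \<open>Away from \<open>X\<close>, a step multiplies \<open>s ^ D v X\<close> in expectation by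
  exactly \<open>\<rho>\<close>. At \<open>X\<close> the bound reduces to
  \<open>q + 1 \<le> 2 * q\<close>.\<close>

lemma expectation_step_decay:
  "measure_pmf.expectation (lazy_step E \<alpha> v) (\<lambda>w. s ^ D w X) \<le> \<rho> * s ^ D v X"
proof -
  have sq: "sqrt (real q) > 0" "sqrt (real q) * sqrt (real q) = real q" using q_ge_2 by auto
  have \<beta>: "0 \<le> \<beta>" using alpha_less_1 by simp
  have "(\<Sum>w\<in>N v. s ^ D w X) \<le> 2 * sqrt (real q) * s ^ D v X"
  proof (cases "v = X")
    case True
    then have "(\<Sum>w\<in>N v. s ^ D w X) = (\<Sum>w\<in>N v. s)"
      by (intro sum.cong) (auto simp: dist_adj adj_sym)
    also have "\<dots> = (real q + 1) / sqrt (real q)" by simp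
    also have "\<dots> \<le> 2 * sqrt (real q)" using sq q_ge_2 by (simp add: divide_le_eq mult.assoc)
    finally show ?thesis using True by simp
  next
    case False
    then obtain w where w: "E v w" "D v X = D w X + 1"
      "\<And>w'. w' \<in> N v - {w} \<Longrightarrow> D w' X = D v X + 1" "card (N v - {w}) = q"
      using neighbors_split by blast
    have "(\<Sum>w\<in>N v. s ^ D w X) = s ^ D w X + (\<Sum>w\<in>N v - {w}. s ^ D w X)"
      using w(1) by (intro sum.remove) auto
    also have "(\<Sum>w\<in>N v - {w}. s ^ D w X) = (\<Sum>w\<in>N v - {w}. s ^ (D v X + 1))"
      using w(3) by (intro sum.cong) auto
    also have "\<dots> = real q * s ^ (D v X + 1)" using w(4) by simp
    also have "real q * s ^ (D v X + 1) = sqrt (real q) * s ^ D v X"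
      using sq by (simp add: field_simps)
    also have "s ^ D w X = sqrt (real q) * s ^ D v X"
      using sq w(2) by simp
    finally show ?thesis by simp
  qed
  from mult_left_mono[OF this \<beta>] show ?thesis
    unfolding expectation_step by (simp add: algebra_simps)
qed

lemma expectation_decay: "measure_pmf.expectation (walk X n) (\<lambda>w. s ^ D w X) \<le> \<rho> ^ n"
proof (induction n)
  case (Suc n)
  have "measure_pmf.expectation (walk X (Suc n)) (\<lambda>w. s ^ D w X) \<le>
      measure_pmf.expectation (walk X n) (\<lambda>v. \<rho> * s ^ D v X)"
    unfolding expectation_walk_Suc
    by (intro integral_mono integrable_walk expectation_step_decay)
  also have "\<dots> = \<rho> * measure_pmf.expectation (walk X n) (\<lambda>v. s ^ D v X)" by simp
  also have "\<dots> \<le> \<rho> * \<rho> ^ n" using Suc rho_bounds(1) by (rule mult_left_mono)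
  finally show ?case by simp
qed simp

text \<open>As \<open>z = s * s\<close>, one factor \<open>s ^ r\<close> absorbs the linear growth
  and the other remains.\<close>

lemma corr_fun_bound: "\<exists>K. \<forall>r. \<bar>corr_fun d r\<bar> \<le> K * s ^ r"
proof -
  have s: "0 < s" "s < 1" using q_ge_2 by auto
  have "(\<lambda>r. harm_coeff d * (real r * s ^ r) - harm_coeff d * corr_center d * s ^ r) \<longlonglongrightarrow>
      harm_coeff d * 0 - harm_coeff d * corr_center d * 0"
    using s by (intro tendsto_intros powser_times_n_limit_0 LIMSEQ_power_zero) auto
  then have "Bseq (\<lambda>r. harm_coeff d * (real r * s ^ r) - harm_coeff d * corr_center d * s ^ r)"
    (is "Bseq ?A") by (intro convergent_imp_Bseq) (auto simp: convergent_def)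
  then obtain K where K: "\<And>r. \<bar>?A r\<bar> \<le> K"
    unfolding Bseq_def by auto
  have "\<bar>corr_fun d r\<bar> \<le> K * s ^ r" for r
  proof -
    have "s * s = z" by simp
    then have "z ^ r = s ^ r * s ^ r" by (metis power_mult_distrib)
    then have "corr_fun d r = ?A r * s ^ r"
      unfolding corr_fun_def by (simp only: algebra_simps)
    then have "\<bar>corr_fun d r\<bar> = \<bar>?A r\<bar> * \<bar>s ^ r\<bar>" by (simp only: abs_mult)
    also have "\<bar>s ^ r\<bar> = s ^ r" using s(1) by simp
    finally show ?thesis using mult_right_mono[OF K[of r], of "s ^ r"] s(1) by simp
  qed
  then show ?thesis by blast
qed

lemma expectation_corr_tendsto_0:
  "(\<lambda>n. measure_pmf.expectation (walk X n) (odd_ext X Y (corr_fun d))) \<longlonglongrightarrow> 0"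
proof -
  obtain K where K: "\<And>r. \<bar>corr_fun d r\<bar> \<le> K * s ^ r" using corr_fun_bound by blast
  have s: "0 < s" "s < 1" using q_ge_2 by auto
  have K0: "0 \<le> K" using K[of 0] by simp
  \<comment> \<open>On the side of \<open>X\<close> the argument \<open>D v Y\<close> exceeds
    \<open>D v X\<close>, so decay from the start \<open>X\<close> controls both sides.\<close>
  have bound: "\<bar>odd_ext X Y (corr_fun d) v\<bar> \<le> K * s ^ D v X" for v
  proof -
    have "\<bar>corr_fun d (D v Y)\<bar> \<le> K * s ^ D v X" if "D v X < D v Y"
    proof -
      have "s ^ D v Y \<le> s ^ D v X" using that s by (intro power_decreasing) auto
      from mult_left_mono[OF this K0] K[of "D v Y"] show ?thesis by linarith
    qed
    then show ?thesis
      using K[of "D v X"] K0 s by (auto simp: odd_ext_def)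
  qed
  have "norm (measure_pmf.expectation (walk X n) (odd_ext X Y (corr_fun d))) \<le> K * \<rho> ^ n" for n
  proof -
    have "\<bar>measure_pmf.expectation (walk X n) (odd_ext X Y (corr_fun d))\<bar> \<le>
        measure_pmf.expectation (walk X n) (\<lambda>v. \<bar>odd_ext X Y (corr_fun d) v\<bar>)"
      by (rule integral_abs_bound)
    also have "\<dots> \<le> measure_pmf.expectation (walk X n) (\<lambda>v. K * s ^ D v X)"
      by (intro integral_mono integrable_walk bound)
    also have "\<dots> = K * measure_pmf.expectation (walk X n) (\<lambda>v. s ^ D v X)" by simp
    also have "\<dots> \<le> K * \<rho> ^ n" using expectation_decay K0 by (rule mult_left_mono)
    finally show ?thesis by (simp only: real_norm_def)
  qed
  then have "\<forall>n. norm (measure_pmf.expectation (walk X n) (odd_ext X Y (corr_fun d))) \<le> K * \<rho> ^ n"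
    by (rule allI)
  moreover have "(\<lambda>n. K * \<rho> ^ n) \<longlonglongrightarrow> 0"
    using tendsto_mult_right_zero[OF LIMSEQ_power_zero[of \<rho>], of K] rho_bounds by simp
  ultimately show ?thesis
    by (rule Lim_null_comparison[OF always_eventually])
qed

lemma expectation_potential:
  assumes "X \<noteq> Y"
  defines "d \<equiv> D X Y"
  shows "(\<lambda>n. measure_pmf.expectation (walk X n) (potential X Y) -
    (\<beta> * (real q - 1) * real n * harm_fun d d + exact_fun d d)) \<longlonglongrightarrow> 0"
proof -
  have "odd_ext X Y (exact_fun d) = (\<lambda>v. potential X Y v + odd_ext X Y (corr_fun d) v)"
    by (auto simp: odd_ext_def exact_fun_def d_def)
  then have "measure_pmf.expectation (walk X n) (odd_ext X Y (exact_fun d)) =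
      measure_pmf.expectation (walk X n) (potential X Y) +
      measure_pmf.expectation (walk X n) (odd_ext X Y (corr_fun d))" for n
    by simp
  then have "measure_pmf.expectation (walk X n) (potential X Y) -
      (\<beta> * (real q - 1) * real n * harm_fun d d + exact_fun d d) =
      - measure_pmf.expectation (walk X n) (odd_ext X Y (corr_fun d))" for n
    using expectation_exact(2)[OF assms(1), of n] by (simp add: d_def)
  then show ?thesis
    using tendsto_minus[OF expectation_corr_tendsto_0[of X Y d]] by simp
qed

section \<open>Closed forms of the coefficients and conclusion\<close>

lemma A_SRW_eq: "A_SRW \<alpha> d q = 2 * (\<beta> * (real q - 1) * harm_fun d d)"
  and B_SRW_eq: "B_SRW \<alpha> d q = 2 * exact_fun d d"
proof -
  have fl: "\<lfloor>real d / 2\<rfloor> = int (d div 2)"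
    by linarith
  have ce: "\<lceil>real d / 2\<rceil> = int (d - d div 2)"
    by linarith
  have q: "real q > 0" "real q \<noteq> 0" "real q + 1 \<noteq> 0" using q_ge_2 by auto
  have p1: "real q powi (- int m) = z ^ m" for m
    by (simp add: power_int_minus power_divide inverse_eq_divide)
  have p2: "real q powi (1 - int m) = real q * z ^ m" for m
    using q by (simp add: power_int_diff power_divide)
  define P where "P = real q + 1"
  have P: "real q + 1 = P" "real q = P - 1" and "P > 2" using q_ge_2 by (auto simp: P_def)
  define m where "m = d div 2"
  define u where "u = z ^ m"
  have u: "u > 0" unfolding u_def by (rule z_pow_pos)
  have "A_SRW \<alpha> d q = 2 * (\<beta> * (real q - 1) * harm_fun d d) \<and> B_SRW \<alpha> d q = 2 * exact_fun d d"
  proof (cases "even d")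
    case True
    then have d: "d = m + m" "d div 2 = m" "d - m = m" by (auto simp: m_def)
    have zd: "z ^ d = u * u" unfolding d(1) u_def by (rule power_add)
    have "harm_coeff d * z ^ d = u" and center: "corr_center d = real m"
      using u unfolding zd harm_coeff_def corr_center_def d(2,3) u_def[symmetric]
      by (auto simp: field_simps)
    then have vals: "harm_fun d d = 1 - u" "corr_fun d d = u * real m"
      unfolding harm_fun_def corr_fun_def center using d(1)
      by (auto simp: algebra_simps)
    show ?thesis
      unfolding A_SRW_def B_SRW_def Let_def fl ce d(2,3) p1 p2 exact_fun_def vals u_def[symmetric]
        of_int_of_nat_eq
      unfolding P using \<open>P > 2\<close> by (simp add: field_simps power2_eq_square)
  next
    case False
    then have d: "d = m + m + 1" "d div 2 = m" "d - m = m + 1" by (auto simp: m_def elim!: oddE)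
    have zd: "z ^ d = u * u * z" "z ^ (m + 1) = u * z" unfolding d(1) u_def by (simp_all only: power_add power_one_right)
    \<comment> \<open>The larger half is \<open>m + 1\<close>, so
      \<open>q powi (1 - \<delta>')\<close> equals \<open>q powi (- \<delta>)\<close>, that is
      \<open>u\<close>.\<close>
    have zq: "real q * (u * z) = u" using q by simp
    have den: "u + u * z = u * (real q + 1) / real q" using q by (simp add: field_simps)
    have coeff: "harm_coeff d = 2 * real q / (u * (real q + 1))"
      and "corr_center d = (real m * real q + real m + 1) / (real q + 1)"
      unfolding harm_coeff_def corr_center_def d(2,3) zd u_def[symmetric] den
      using u q by (simp_all add: divide_simps) (simp_all add: algebra_simps)?
    then have center: "corr_center d = (real m * P + 1) / P"
      by (simp add: P_def algebra_simps)
    have coeff': "harm_coeff d * z ^ d = 2 * u / P"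
      unfolding coeff zd(1) P_def using u q by simp
    have "corr_fun d d = harm_coeff d * z ^ d * (real d - corr_center d)"
      unfolding corr_fun_def by (simp only: mult_ac)
    with coeff' have vals: "harm_fun d d = 1 - 2 * u / P"
      "corr_fun d d = 2 * u / P * (real d - (real m * P + 1) / P)"
      unfolding harm_fun_def center by simp_all
    have "real d = 2 * real m + 1" using d(1) by simp
    then show ?thesis
      unfolding A_SRW_def B_SRW_def Let_def fl ce d(2,3) p1 p2 exact_fun_def vals zd(2)
        u_def[symmetric] zq of_int_of_nat_eq
      unfolding P using \<open>P > 2\<close> by (simp add: field_simps power2_eq_square)
  qed
  then show "A_SRW \<alpha> d q = 2 * (\<beta> * (real q - 1) * harm_fun d d)" "B_SRW \<alpha> d q = 2 * exact_fun d d"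
    by auto
qed

text \<open>As \<open>potential\<close> changes sign under exchange of \<open>X\<close> and
  \<open>Y\<close>, both walks contribute the same asymptotic expression, whence the factor 2 in
  \<open>A_SRW_eq\<close> and \<open>B_SRW_eq\<close>.\<close>

lemma wasserstein1_walk_asymptotics:
  assumes "X \<noteq> Y"
  shows "(\<lambda>n. wasserstein1 E (walk X n) (walk Y n) -
    (A_SRW \<alpha> (D X Y) q * real n + B_SRW \<alpha> (D X Y) q)) \<longlonglongrightarrow> 0"
proof -
  let ?d = "D X Y"
  let ?e = "\<lambda>n. \<beta> * (real q - 1) * real n * harm_fun ?d ?d + exact_fun ?d ?d"
  have "potential X Y = (\<lambda>v. - potential Y X v)"
    by (simp add: dist_commute[of Y X] odd_ext_swap[of Y X])
  then have "measure_pmf.expectation (walk Y n) (potential X Y) =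
      - measure_pmf.expectation (walk Y n) (potential Y X)" for n
    by (subst \<open>potential X Y = _\<close>) simp
  then have "wasserstein1 E (walk X n) (walk Y n) - (A_SRW \<alpha> ?d q * real n + B_SRW \<alpha> ?d q) =
    (measure_pmf.expectation (walk X n) (potential X Y) - ?e n) +
    (measure_pmf.expectation (walk Y n) (potential Y X) - ?e n)" for n
    unfolding wasserstein1_walk A_SRW_eq B_SRW_eq by (simp add: algebra_simps)
  moreover have "(\<lambda>n. measure_pmf.expectation (walk Y n) (potential Y X) - ?e n) \<longlonglongrightarrow> 0"
    using expectation_potential[of Y X] assms by (simp add: dist_commute[of Y X])
  ultimately show ?thesis
    using tendsto_add[OF expectation_potential[OF assms]] by fastforce
qed

end

theorem theorem7p10:
  fixes E :: "'v \<Rightarrow> 'v \<Rightarrow> bool" and X Y :: 'v and q d :: nat and \<alpha> :: real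
  assumes "q \<ge> 2" and "d \<ge> 1" and "0 \<le> \<alpha>" and "\<alpha> < 1"
    and "is_tree E" and "regular_graph (q + 1) E"
    and "graph_dist E X Y = d"
  shows "(\<lambda>n. wasserstein1 E (lazy_walk E \<alpha> X n) (lazy_walk E \<alpha> Y n)
              - (A_SRW \<alpha> d q * real n + B_SRW \<alpha> d q)) \<in> o(\<lambda>n. 1)"
proof -
  interpret lazy_walk_tree E q \<alpha>
    using assms by unfold_locales auto
  have "X \<noteq> Y" using assms(2,7) by auto
  from wasserstein1_walk_asymptotics[OF this] show ?thesis
    unfolding assms(7) by (intro smalloI_tendsto) auto
qed

end
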